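(* Let $\mathcal{C}$ be a class of groups and let $\mathcal{L}$ be a set-theoretic (respectively graph-theoretic) halo of groups. Suppose that for every finite set (respectively finite graph) $X$ the group $L(X)$ lies in $\mathcal{C}$. Then for any set (respectively graph) $X$ and any sofic group action $\Gamma\curvearrowright_{\alpha}X$, the induced action $\hat{\alpha}:\Gamma\to\operatorname{Aut}(L(X))$ is a sofic $\mathcal{C}$-action.
   Context: Haloes. A halo of groups over a set $X$ is a family of groups $\{L(Y):Y\subseteq X\}$ such that (i) $L(Z)\leq L(Y)$ for all $Z\subseteq Y\subseteq X$; (ii) $L(\emptyset)$ is trivial and $L(X)=\langle L(Y):Y\subseteq X\text{ finite}\rangle$; (iii) $L(Y\cap Z)=L(Y)\cap L(Z)$ for all $Y,Z\subseteq X$. For a graph $X$, subsets of the vertex set are identified with induced subgraphs of $X$. A set-theoretic (respectively graph-theoretic) halo of groups is a covariant functor $\mathcal{L}$, written $X\mapsto L(X)$ on objects and $\pi\mapsto\hat\pi$ on morphisms, from the category of sets with injective functions (respectively graphs with inclusions of induced subgraphs, i.e. injective vertex maps preserving both adjacency and non-adjacency) to the category of groups with monomorphisms, such that for every set (graph) $X$ the family $\{\hat{\iota}(L(Y)):Y\subseteq X\}$ is a halo of groups over $X$, where $\iota:Y\hookrightarrow X$ is the inclusion. A group action $\Gamma\curvearrowright_\alpha X$ (by permutations, respectively graph automorphisms) induces the action $\hat\alpha:\Gamma\to\operatorname{Aut}(L(X))$, $\hat\alpha(g)=\widehat{\alpha(g)}$. Multiplicativity. For a finite set $A$ let $d_A(\sigma,\tau)=1-\frac{1}{|A|}|\{a\in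 A:\sigma(a)=\tau(a)\}|$ on $\operatorname{Sym}(A)$. A function $\varphi:\Gamma\to\operatorname{Sym}(A)$ is unital if $\varphi(e)=e$, and $(F,\epsilon)$-multiplicative if $d_A(\varphi(gh),\varphi(g)\varphi(h))<\epsilon$ for all $g,h\in F$ with $gh\in F$. Sofic actions on sets and graphs. Given $\Gamma\curvearrowright_\alpha X$ on a set, finite $F\subseteq\Gamma$, $E\subseteq X$, and $\epsilon>0$, a function $\varphi:\Gamma\to\operatorname{Sym}(A)$ ($A$ finite) is an $(F,E,\epsilon)$-orbit approximation of $\alpha$ if there exist a finite set $B$, a subset $S\subseteq A$ with $|S|>(1-\epsilon)|A|$, and injective functions $(\pi_s:E\hookrightarrow B)_{s\in S}$ such that for all $g\in F$, $x\in E$, $s\in S$, if $\varphi(g)\cdot s\in S$ and $\alpha(g)^{-1}\cdot x\in E$ then $\pi_{\varphi(g)\cdot s}(x)=\pi_s(\alpha(g)^{-1}\cdot x)$. The action $\alpha$ is sofic if for all such $F,E,\epsilon$ there exist a finite set $A$ and a unital $(F,\epsilon)$-multiplicative $(F,E,\epsilon)$-orbit approximation $\varphi:\Gamma\to\operatorname{Sym}(A)$ of $\alpha$. For actions on graphs by automorphisms the definition is the same, with $E$ a finite induced subgraph of $X$, $B$ a finite graph, and the $\pi_s$ inclusions of induced subgraphs. Sofic actions on groups. A partial homomorphism from a subset $E$ of a group to a group $\Lambda$ is a function $\pi$ with $\pi(gh)=\pi(g)\pi(h)$ whenever $g,h,gh\in E$. Given a homomorphism $\alpha:\Gamma\to\operatorname{Aut}(\Delta)$,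 finite $F\subseteq\Gamma$, $E\subseteq\Delta$, $\epsilon>0$ and a group $\Lambda$, a function $\varphi:\Gamma\to\operatorname{Sym}(A)$ ($A$ finite) is an $(F,E,\epsilon,\Lambda)$-automorphic approximation of $\alpha$ if there exist $S\subseteq A$ with $|S|>(1-\epsilon)|A|$ and injective partial homomorphisms $(\pi_s:E\hookrightarrow\Lambda)_{s\in S}$ such that for all $g\in F$, $h\in E$, $s\in S$, if $\varphi(g)\cdot s\in S$ and $\alpha(g)^{-1}[h]\in E$ then $\pi_{\varphi(g)\cdot s}(h)=\pi_s(\alpha(g)^{-1}[h])$. The action $\alpha$ is a sofic $\mathcal{C}$-action if for all finite $F\subseteq\Gamma$, $E\subseteq\Delta$ and $\epsilon>0$ there exist $\Lambda\in\mathcal{C}$, a finite set $A$ and a unital $(F,\epsilon)$-multiplicative $(F,E,\epsilon,\Lambda)$-automorphic approximation $\varphi:\Gamma\to\operatorname{Sym}(A)$ of $\alpha$. *)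

theory Defs
  imports
    Complex_Main
    "HOL-Algebra.Group_Action"
    "HOL-Algebra.Generated_Groups"
    "Graph_Theory.Pair_Digraph"
begin

section \<open>Haloes of groups over a set\<close>

definition is_subgroup_of :: "'g monoid \<Rightarrow> 'g monoid \<Rightarrow> bool" where
  "is_subgroup_of H G \<longleftrightarrow> subgroup (carrier H) G \<and>
     (\<forall>x \<in> carrier H. \<forall>y \<in> carrier H. x \<otimes>\<^bsub>H\<^esub> y = x \<otimes>\<^bsub>G\<^esub> y)"

definition halo_of_groups :: "'a set \<Rightarrow> ('a set \<Rightarrow> 'g monoid) \<Rightarrow> bool" where
  "halo_of_groups X K \<longleftrightarrow>
     (\<forall>Y. Y \<subseteq> X \<longrightarrow> group (K Y)) \<and>
     (\<forall>Y Z. Z \<subseteq> Y \<and> Y \<subseteq> X \<longrightarrow> is_subgroup_of (K Z) (K Y)) \<and>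
     carrier (K {}) = {\<one>\<^bsub>K {}\<^esub>} \<and>
     carrier (K X) = generate (K X) (\<Union>Y \<in> {Y. Y \<subseteq> X \<and> finite Y}. carrier (K Y)) \<and>
     (\<forall>Y Z. Y \<subseteq> X \<and> Z \<subseteq> X \<longrightarrow> carrier (K (Y \<inter> Z)) = carrier (K Y) \<inter> carrier (K Z))"


section \<open>The categories of sets and of graphs\<close>

text \<open>
  Morphisms are represented by extensional functions, so that a morphism is determined by its
  values on the domain.

  A (simple, undirected, possibly infinite) graph is a pair digraph whose arc relation is
  symmetric and irreflexive, that is, \<^const>\<open>pair_bidirected_digraph\<close>; vertices are adjacent when
  they form an arc.
\<close>

definition set_inclusions :: "'a set \<Rightarrow> 'b set \<Rightarrow> ('a \<Rightarrow> 'b) set" where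
  "set_inclusions X Y = {f \<in> X \<rightarrow>\<^sub>E Y. inj_on f X}"

definition graph_inclusions ::
    "'a pair_pre_digraph \<Rightarrow> 'b pair_pre_digraph \<Rightarrow> ('a \<Rightarrow> 'b) set" where
  "graph_inclusions X Y = {f \<in> set_inclusions (pverts X) (pverts Y).
     \<forall>x \<in> pverts X. \<forall>y \<in> pverts X. (x, y) \<in> parcs X \<longleftrightarrow> (f x, f y) \<in> parcs Y}"

definition induced_on :: "'a pair_pre_digraph \<Rightarrow> 'a set \<Rightarrow> 'a pair_pre_digraph" where
  "induced_on X Y = \<lparr>pverts = Y, parcs = parcs X \<inter> (Y \<times> Y)\<rparr>"


section \<open>Set-theoretic and graph-theoretic haloes of groups\<close>

text \<open>
  The objects of the source category are the subsets of a type \<open>'a\<close> (respectively the graphs with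
  vertices in \<open>'a\<close>), which plays the role of a universe. Whenever \<open>'a\<close> is infinite, every finite
  set (graph) has an isomorphic copy among the objects. \<open>Lmap X Y f\<close> is the homomorphism
  assigned to the morphism \<open>f\<close> from \<open>X\<close> to \<open>Y\<close>; only its values on the carrier of \<open>L X\<close> matter.
\<close>

locale set_theoretic_halo =
  fixes L :: "'a set \<Rightarrow> 'g monoid"
    and Lmap :: "'a set \<Rightarrow> 'a set \<Rightarrow> ('a \<Rightarrow> 'a) \<Rightarrow> 'g \<Rightarrow> 'g"
  assumes group_L: "group (L X)"
    and map_mon: "f \<in> set_inclusions X Y \<Longrightarrow> Lmap X Y f \<in> mon (L X) (L Y)"
    and map_id: "u \<in> carrier (L X) \<Longrightarrow> Lmap X X (\<lambda>x\<in>X. x) u = u"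
    and map_comp: "\<lbrakk>f \<in> set_inclusions X Y; g \<in> set_inclusions Y Z; u \<in> carrier (L X)\<rbrakk>
          \<Longrightarrow> Lmap X Z (compose X g f) u = Lmap Y Z g (Lmap X Y f u)"
    and halo: "halo_of_groups X
          (\<lambda>Y. (L X)\<lparr>carrier := Lmap Y X (\<lambda>y\<in>Y. y) ` carrier (L Y)\<rparr>)"

locale graph_theoretic_halo =
  fixes L :: "'a pair_pre_digraph \<Rightarrow> 'g monoid"
    and Lmap :: "'a pair_pre_digraph \<Rightarrow> 'a pair_pre_digraph \<Rightarrow> ('a \<Rightarrow> 'a) \<Rightarrow> 'g \<Rightarrow> 'g"
  assumes group_L: "pair_bidirected_digraph X \<Longrightarrow> group (L X)"
    and map_mon: "\<lbrakk>pair_bidirected_digraph X; pair_bidirected_digraph Y;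
          f \<in> graph_inclusions X Y\<rbrakk> \<Longrightarrow> Lmap X Y f \<in> mon (L X) (L Y)"
    and map_id: "\<lbrakk>pair_bidirected_digraph X; u \<in> carrier (L X)\<rbrakk>
          \<Longrightarrow> Lmap X X (\<lambda>x\<in>pverts X. x) u = u"
    and map_comp: "\<lbrakk>pair_bidirected_digraph X; pair_bidirected_digraph Y;
          pair_bidirected_digraph Z; f \<in> graph_inclusions X Y; g \<in> graph_inclusions Y Z;
          u \<in> carrier (L X)\<rbrakk>
          \<Longrightarrow> Lmap X Z (compose (pverts X) g f) u = Lmap Y Z g (Lmap X Y f u)"
    and halo: "pair_bidirected_digraph X \<Longrightarrow> halo_of_groups (pverts X)
          (\<lambda>Y. (L X)\<lparr>carrier := Lmap (induced_on X Y) X (\<lambda>y\<in>Y. y) ` carrier (L (induced_on X Y))\<rparr>)"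

text \<open>
  For an action \<open>\<alpha>\<close> on the object \<open>X\<close>, \<open>induced_action (L X) (Lmap X X) \<alpha>\<close> is the induced
  action on \<open>L X\<close>. The restriction turns \<open>Lmap X X (\<alpha> g)\<close> into an element of
  \<open>AutoGroup (L X)\<close>, whose elements are extensional.
\<close>

definition induced_action ::
    "'g monoid \<Rightarrow> (('a \<Rightarrow> 'a) \<Rightarrow> 'g \<Rightarrow> 'g) \<Rightarrow> ('c \<Rightarrow> 'a \<Rightarrow> 'a) \<Rightarrow> 'c \<Rightarrow> 'g \<Rightarrow> 'g" where
  "induced_action G h \<alpha> = (\<lambda>g. restrict (h (\<alpha> g)) (carrier G))"


section \<open>Almost multiplicative maps to finite symmetric groups\<close>

text \<open>The group \<open>Sym A\<close> is \<^const>\<open>BijGroup\<close>.\<close>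

definition hamming_dist :: "'b set \<Rightarrow> ('b \<Rightarrow> 'b) \<Rightarrow> ('b \<Rightarrow> 'b) \<Rightarrow> real" where
  "hamming_dist A \<sigma> \<tau> = 1 - 1 / real (card A) * real (card {a \<in> A. \<sigma> a = \<tau> a})"

definition unital :: "'c monoid \<Rightarrow> 'b set \<Rightarrow> ('c \<Rightarrow> 'b \<Rightarrow> 'b) \<Rightarrow> bool" where
  "unital \<Gamma> A \<phi> \<longleftrightarrow> \<phi> \<one>\<^bsub>\<Gamma>\<^esub> = \<one>\<^bsub>BijGroup A\<^esub>"

definition multiplicative ::
    "'c monoid \<Rightarrow> 'c set \<Rightarrow> real \<Rightarrow> 'b set \<Rightarrow> ('c \<Rightarrow> 'b \<Rightarrow> 'b) \<Rightarrow> bool" where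
  "multiplicative \<Gamma> F \<epsilon> A \<phi> \<longleftrightarrow> (\<forall>g \<in> F. \<forall>h \<in> F. g \<otimes>\<^bsub>\<Gamma>\<^esub> h \<in> F \<longrightarrow>
     hamming_dist A (\<phi> (g \<otimes>\<^bsub>\<Gamma>\<^esub> h)) (\<phi> g \<otimes>\<^bsub>BijGroup A\<^esub> \<phi> h) < \<epsilon>)"


section \<open>Sofic actions\<close>

text \<open>
  The finite sets \<open>A\<close> and \<open>B\<close> whose existence is required below only matter up to bijection, so
  they are taken among the finite sets of natural numbers.
\<close>

subsection \<open>Actions on sets\<close>

definition set_orbit_approximation ::
    "'c monoid \<Rightarrow> 'a set \<Rightarrow> ('c \<Rightarrow> 'a \<Rightarrow> 'a) \<Rightarrow> 'c set \<Rightarrow> 'a set \<Rightarrow> real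
      \<Rightarrow> 'b set \<Rightarrow> ('c \<Rightarrow> 'b \<Rightarrow> 'b) \<Rightarrow> bool" where
  "set_orbit_approximation \<Gamma> X \<alpha> F E \<epsilon> A \<phi> \<longleftrightarrow>
     \<phi> \<in> carrier \<Gamma> \<rightarrow> carrier (BijGroup A) \<and>
     (\<exists>(B :: nat set) S \<pi>. finite B \<and> S \<subseteq> A \<and> real (card S) > (1 - \<epsilon>) * real (card A) \<and>
        (\<forall>s \<in> S. \<pi> s \<in> set_inclusions E B) \<and>
        (\<forall>g \<in> F. \<forall>x \<in> E. \<forall>s \<in> S. \<phi> g s \<in> S \<and> (inv\<^bsub>BijGroup X\<^esub> (\<alpha> g)) x \<in> E \<longrightarrow>
           \<pi> (\<phi> g s) x = \<pi> s ((inv\<^bsub>BijGroup X\<^esub> (\<alpha> g)) x)))"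

definition sofic_set_action :: "'c monoid \<Rightarrow> 'a set \<Rightarrow> ('c \<Rightarrow> 'a \<Rightarrow> 'a) \<Rightarrow> bool" where
  "sofic_set_action \<Gamma> X \<alpha> \<longleftrightarrow> group_action \<Gamma> X \<alpha> \<and>
     (\<forall>F E \<epsilon>. finite F \<and> F \<subseteq> carrier \<Gamma> \<and> finite E \<and> E \<subseteq> X \<and> \<epsilon> > 0 \<longrightarrow>
        (\<exists>(A :: nat set) \<phi>. finite A \<and> unital \<Gamma> A \<phi> \<and> multiplicative \<Gamma> F \<epsilon> A \<phi> \<and>
           set_orbit_approximation \<Gamma> X \<alpha> F E \<epsilon> A \<phi>))"

subsection \<open>Actions on graphs\<close>

definition graph_action :: "'c monoid \<Rightarrow> 'a pair_pre_digraph \<Rightarrow> ('c \<Rightarrow> 'a \<Rightarrow> 'a) \<Rightarrow> bool" where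
  "graph_action \<Gamma> X \<alpha> \<longleftrightarrow> pair_bidirected_digraph X \<and> group_action \<Gamma> (pverts X) \<alpha> \<and>
     (\<forall>g \<in> carrier \<Gamma>. \<forall>x \<in> pverts X. \<forall>y \<in> pverts X.
        (x, y) \<in> parcs X \<longleftrightarrow> (\<alpha> g x, \<alpha> g y) \<in> parcs X)"

definition graph_orbit_approximation ::
    "'c monoid \<Rightarrow> 'a pair_pre_digraph \<Rightarrow> ('c \<Rightarrow> 'a \<Rightarrow> 'a) \<Rightarrow> 'c set \<Rightarrow> 'a set \<Rightarrow> real
      \<Rightarrow> 'b set \<Rightarrow> ('c \<Rightarrow> 'b \<Rightarrow> 'b) \<Rightarrow> bool" where
  "graph_orbit_approximation \<Gamma> X \<alpha> F E \<epsilon> A \<phi> \<longleftrightarrow>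
     \<phi> \<in> carrier \<Gamma> \<rightarrow> carrier (BijGroup A) \<and>
     (\<exists>(B :: nat pair_pre_digraph) S \<pi>. pair_bidirected_digraph B \<and> finite (pverts B) \<and>
        S \<subseteq> A \<and> real (card S) > (1 - \<epsilon>) * real (card A) \<and>
        (\<forall>s \<in> S. \<pi> s \<in> graph_inclusions (induced_on X E) B) \<and>
        (\<forall>g \<in> F. \<forall>x \<in> E. \<forall>s \<in> S. \<phi> g s \<in> S \<and> (inv\<^bsub>BijGroup (pverts X)\<^esub> (\<alpha> g)) x \<in> E \<longrightarrow>
           \<pi> (\<phi> g s) x = \<pi> s ((inv\<^bsub>BijGroup (pverts X)\<^esub> (\<alpha> g)) x)))"

definition sofic_graph_action ::
    "'c monoid \<Rightarrow> 'a pair_pre_digraph \<Rightarrow> ('c \<Rightarrow> 'a \<Rightarrow> 'a) \<Rightarrow> bool" where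
  "sofic_graph_action \<Gamma> X \<alpha> \<longleftrightarrow> graph_action \<Gamma> X \<alpha> \<and>
     (\<forall>F E \<epsilon>. finite F \<and> F \<subseteq> carrier \<Gamma> \<and> finite E \<and> E \<subseteq> pverts X \<and> \<epsilon> > 0 \<longrightarrow>
        (\<exists>(A :: nat set) \<phi>. finite A \<and> unital \<Gamma> A \<phi> \<and> multiplicative \<Gamma> F \<epsilon> A \<phi> \<and>
           graph_orbit_approximation \<Gamma> X \<alpha> F E \<epsilon> A \<phi>))"

subsection \<open>Actions on groups\<close>

definition partial_hom :: "'d monoid \<Rightarrow> 'd set \<Rightarrow> 'g monoid \<Rightarrow> ('d \<Rightarrow> 'g) set" where
  "partial_hom \<Delta> E \<Lambda> = {p \<in> E \<rightarrow> carrier \<Lambda>.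
     \<forall>g \<in> E. \<forall>h \<in> E. g \<otimes>\<^bsub>\<Delta>\<^esub> h \<in> E \<longrightarrow> p (g \<otimes>\<^bsub>\<Delta>\<^esub> h) = p g \<otimes>\<^bsub>\<Lambda>\<^esub> p h}"

definition automorphic_approximation ::
    "'c monoid \<Rightarrow> 'd monoid \<Rightarrow> ('c \<Rightarrow> 'd \<Rightarrow> 'd) \<Rightarrow> 'c set \<Rightarrow> 'd set \<Rightarrow> real \<Rightarrow> 'g monoid
      \<Rightarrow> 'b set \<Rightarrow> ('c \<Rightarrow> 'b \<Rightarrow> 'b) \<Rightarrow> bool" where
  "automorphic_approximation \<Gamma> \<Delta> \<alpha> F E \<epsilon> \<Lambda> A \<phi> \<longleftrightarrow>
     \<phi> \<in> carrier \<Gamma> \<rightarrow> carrier (BijGroup A) \<and>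
     (\<exists>S \<pi>. S \<subseteq> A \<and> real (card S) > (1 - \<epsilon>) * real (card A) \<and>
        (\<forall>s \<in> S. \<pi> s \<in> partial_hom \<Delta> E \<Lambda> \<and> inj_on (\<pi> s) E) \<and>
        (\<forall>g \<in> F. \<forall>h \<in> E. \<forall>s \<in> S. \<phi> g s \<in> S \<and> (inv\<^bsub>AutoGroup \<Delta>\<^esub> (\<alpha> g)) h \<in> E \<longrightarrow>
           \<pi> (\<phi> g s) h = \<pi> s ((inv\<^bsub>AutoGroup \<Delta>\<^esub> (\<alpha> g)) h)))"

definition sofic_class_action ::
    "'g monoid set \<Rightarrow> 'c monoid \<Rightarrow> 'd monoid \<Rightarrow> ('c \<Rightarrow> 'd \<Rightarrow> 'd) \<Rightarrow> bool" where
  "sofic_class_action \<C> \<Gamma> \<Delta> \<alpha> \<longleftrightarrow>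
     group \<Gamma> \<and> group \<Delta> \<and> \<alpha> \<in> hom \<Gamma> (AutoGroup \<Delta>) \<and>
     (\<forall>F E \<epsilon>. finite F \<and> F \<subseteq> carrier \<Gamma> \<and> finite E \<and> E \<subseteq> carrier \<Delta> \<and> \<epsilon> > 0 \<longrightarrow>
        (\<exists>\<Lambda> \<in> \<C>. \<exists>(A :: nat set) \<phi>. finite A \<and> unital \<Gamma> A \<phi> \<and> multiplicative \<Gamma> F \<epsilon> A \<phi> \<and>
           automorphic_approximation \<Gamma> \<Delta> \<alpha> F E \<epsilon> \<Lambda> A \<phi>))"

end

theory Submission
  imports Defs
begin

text \<open>
  A finite set \<open>E\<close> of elements of \<open>L(X)\<close> is supported on a finite set \<open>Y\<close> of vertices, since the
  groups \<open>L(Y)\<close> with \<open>Y\<close> finite are directed. An orbit approximation given by \<open>\<pi>\<^sub>s : Y \<rightarrow> B\<close> is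
  turned into an automorphic approximation by the injective homomorphisms \<open>L(\<pi>\<^sub>s) : L(Y) \<rightarrow> L(B)\<close>.
  If both \<open>h\<close> and \<open>\<alpha>(g)\<^bsup>-1\<^esup>h\<close> are supported on \<open>Y\<close>, then by the intersection axiom \<open>h\<close> is supported
  on \<open>D = Y \<inter> \<alpha>(g)Y\<close>; there \<open>\<pi>\<^bsub>\<phi>(g)s\<^esub>\<close> and \<open>\<pi>\<^sub>s \<circ> \<alpha>(g)\<^bsup>-1\<^esup>\<close> agree, hence so do the maps that they
  induce on \<open>L(D)\<close>. The statement for sets is the case of edgeless graphs.
\<close>

section \<open>Graphs, induced subgraphs and their inclusions\<close>

lemma pair_bidirected_digraph_iff:
  "pair_bidirected_digraph G \<longleftrightarrow>
     parcs G \<subseteq> pverts G \<times> pverts G \<and> sym (parcs G) \<and> irrefl (parcs G)"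
proof
  assume "pair_bidirected_digraph G"
  then interpret pair_bidirected_digraph G .
  show "parcs G \<subseteq> pverts G \<times> pverts G \<and> sym (parcs G) \<and> irrefl (parcs G)"
  proof (intro conjI)
    show "parcs G \<subseteq> pverts G \<times> pverts G"
      using arc_fst_in_verts arc_snd_in_verts by fastforce
    show "sym (parcs G)" by (rule symI) (rule arcs_symmetric)
    show "irrefl (parcs G)" using pair_no_loops by (fastforce simp: irrefl_def)
  qed
next
  assume "parcs G \<subseteq> pverts G \<times> pverts G \<and> sym (parcs G) \<and> irrefl (parcs G)"
  then show "pair_bidirected_digraph G"
    by unfold_locales (auto simp: symmetric_def irrefl_def)
qed

lemma pverts_induced_on [simp]: "pverts (induced_on X Y) = Y"
  by (simp add: induced_on_def)

lemma parcs_induced_on [simp]: "parcs (induced_on X Y) = parcs X \<inter> Y \<times> Y"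
  by (simp add: induced_on_def)

lemma induced_on_pverts:
  assumes "pair_bidirected_digraph X"
  shows "induced_on X (pverts X) = X"
  using assms by (simp add: pair_bidirected_digraph_iff induced_on_def Int_absorb2)

lemma bidirected_induced_on:
  assumes "pair_bidirected_digraph X"
  shows "pair_bidirected_digraph (induced_on X Y)"
  using assms by (auto simp: pair_bidirected_digraph_iff sym_def irrefl_def)

lemma compose_graph_inclusions:
  assumes "f \<in> graph_inclusions X Y" "g \<in> graph_inclusions Y Z"
  shows "compose (pverts X) g f \<in> graph_inclusions X Z"
  using assms
  by (auto simp: graph_inclusions_def set_inclusions_def compose_def inj_on_def PiE_iff)

lemma restrict_graph_inclusions:
  assumes "f \<in> graph_inclusions X Y" "D \<subseteq> pverts X" "f ` D \<subseteq> W"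
  shows "restrict f D \<in> graph_inclusions (induced_on X D) (induced_on Y W)"
  using assms
  by (auto simp: graph_inclusions_def set_inclusions_def inj_on_def PiE_iff subset_iff image_subset_iff)

lemma id_graph_inclusions: "(\<lambda>x\<in>pverts X. x) \<in> graph_inclusions X X"
  by (auto simp: graph_inclusions_def set_inclusions_def inj_on_def)

lemma inclusion_graph_inclusions:
  assumes "Y \<subseteq> pverts X"
  shows "(\<lambda>y\<in>Y. y) \<in> graph_inclusions (induced_on X Y) X"
  using assms by (auto simp: graph_inclusions_def set_inclusions_def inj_on_def)

text \<open>Replaces finite graphs on natural numbers by graphs in the universe of the halo.\<close>

lemma graph_inclusion_into_universe:
  fixes B :: "nat pair_pre_digraph"
  assumes "infinite (UNIV :: 'a set)" "pair_bidirected_digraph B" "finite (pverts B)"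
  obtains B' :: "'a pair_pre_digraph" and c
  where "pair_bidirected_digraph B'" "finite (pverts B')" "c \<in> graph_inclusions B B'"
proof -
  obtain c :: "nat \<Rightarrow> 'a" where c: "inj c"
    using infinite_countable_subset[OF assms(1)] by blast
  define R where "R = map_prod c c ` parcs B"
  let ?B = "\<lparr>pverts = c ` pverts B, parcs = R\<rparr>"
  have B: "parcs B \<subseteq> pverts B \<times> pverts B" "sym (parcs B)" "irrefl (parcs B)"
    using assms(2) by (simp_all add: pair_bidirected_digraph_iff)
  have "R \<subseteq> c ` pverts B \<times> c ` pverts B" using B(1) by (auto simp: R_def)
  moreover have "sym R" using B(2) by (force simp: R_def sym_def)
  moreover have "irrefl R" using B(3) c by (auto simp: R_def irrefl_def inj_eq)
  ultimately have "pair_bidirected_digraph ?B" by (simp add: pair_bidirected_digraph_iff)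
  \<comment> \<open>Injectivity of \<open>map_prod c c\<close> gives the direction from
    \<open>R\<close> back to \<open>parcs B\<close>, so non-adjacency is preserved as well.\<close>
  moreover have "(c x, c y) \<in> R \<longleftrightarrow> (x, y) \<in> parcs B" for x y
    using inj_image_mem_iff[OF prod.inj_map[OF c c], of "(x, y)" "parcs B"] by (simp add: R_def)
  then have "restrict c (pverts B) \<in> graph_inclusions B ?B"
    using inj_on_subset[OF c subset_UNIV] by (simp add: graph_inclusions_def set_inclusions_def)
  ultimately show thesis using assms(3) by (intro that[of ?B "restrict c (pverts B)"]) simp_all
qed

section \<open>Subgroups of L(X) indexed by vertex sets, and finite supports\<close>

context graph_theoretic_halo
begin

definition incl :: "'a pair_pre_digraph \<Rightarrow> 'a set \<Rightarrow> 'g \<Rightarrow> 'g" where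
  "incl X Y = Lmap (induced_on X Y) X (\<lambda>y\<in>Y. y)"

text \<open>Functoriality makes L(Y) embed into L(X) without being a subset of it. The member of the
  halo over \<open>pverts X\<close> indexed by \<open>Y\<close> is therefore the image of this
  embedding.\<close>

definition supported :: "'a pair_pre_digraph \<Rightarrow> 'a set \<Rightarrow> 'g set" where
  "supported X Y = incl X Y ` carrier (L (induced_on X Y))"

lemma Lmap_closed:
  assumes "pair_bidirected_digraph X" "pair_bidirected_digraph Y" "f \<in> graph_inclusions X Y"
    "u \<in> carrier (L X)"
  shows "Lmap X Y f u \<in> carrier (L Y)"
  using map_mon[OF assms(1-3)] assms(4) by (auto simp: mon_def hom_def)

lemma incl_mon:
  assumes "pair_bidirected_digraph X" "Y \<subseteq> pverts X"
  shows "incl X Y \<in> mon (L (induced_on X Y)) (L X)"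
  unfolding incl_def
  using assms by (intro map_mon bidirected_induced_on inclusion_graph_inclusions)

lemma supported_subgroup:
  assumes "pair_bidirected_digraph X" "Y \<subseteq> pverts X"
  shows "subgroup (supported X Y) (L X)"
proof -
  interpret group_hom "L (induced_on X Y)" "L X" "incl X Y"
    using incl_mon[OF assms] assms
    by (auto simp: group_hom_def group_hom_axioms_def mon_def intro!: group_L bidirected_induced_on)
  show ?thesis unfolding supported_def by (rule img_is_subgroup)
qed

lemma supported_pverts:
  assumes "pair_bidirected_digraph X"
  shows "supported X (pverts X) = carrier (L X)"
  using assms by (auto simp: supported_def incl_def induced_on_pverts map_id image_iff)

lemma supported_Int:
  assumes "pair_bidirected_digraph X" "Y \<subseteq> pverts X" "Z \<subseteq> pverts X"
  shows "supported X (Y \<inter> Z) = supported X Y \<inter> supported X Z"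
  using halo[OF assms(1)] assms(2,3)
  unfolding halo_of_groups_def supported_def incl_def by simp

text \<open>If Z lies in Y then Z is the intersection of Z and Y, so monotonicity is an instance of
  the intersection axiom.\<close>

lemma supported_mono:
  assumes "pair_bidirected_digraph X" "Z \<subseteq> Y" "Y \<subseteq> pverts X"
  shows "supported X Z \<subseteq> supported X Y"
  using supported_Int[of X Z Y] assms by (simp add: Int_absorb2) blast

lemma carrier_generated_by_finite:
  assumes "pair_bidirected_digraph X"
  shows "carrier (L X) = generate (L X) (\<Union>Y \<in> {Y. Y \<subseteq> pverts X \<and> finite Y}. supported X Y)"
proof -
  \<comment> \<open>The halo axiom generates inside the member indexed by the whole vertex set. The
    inclusion of X in itself is the identity morphism, so this member is L(X) itself.\<close>
  have "(L X)\<lparr>carrier := supported X (pverts X)\<rparr> = L X"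
    using supported_pverts[OF assms] by simp
  then show ?thesis
    using halo[OF assms] supported_pverts[OF assms]
    unfolding halo_of_groups_def supported_def incl_def by simp
qed

text \<open>The elements with a finite support are closed under products, because two supports can
  be replaced by their union, and each \<open>supported X Y\<close> is closed under inverses. Hence
  they exhaust the group that the subgroups with finite Y generate, which is L(X).\<close>

lemma finite_support:
  assumes X: "pair_bidirected_digraph X" and u: "u \<in> carrier (L X)"
  obtains Y where "finite Y" "Y \<subseteq> pverts X" "u \<in> supported X Y"
proof -
  have "\<exists>Y. finite Y \<and> Y \<subseteq> pverts X \<and> u \<in> supported X Y"
    using u[unfolded carrier_generated_by_finite[OF X]]
  proof (induction u rule: generate.induct)
    case one
    show ?case
      using subgroup.one_closed[OF supported_subgroup[OF X]] by (intro exI[of _ "{}"]) simp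
  next
    case (incl h)
    then show ?case by blast
  next
    case (inv h)
    then show ?case using subgroup.m_inv_closed[OF supported_subgroup[OF X]] by blast
  next
    case (eng h1 h2)
    then obtain Y1 Y2 where *: "finite Y1" "Y1 \<subseteq> pverts X" "h1 \<in> supported X Y1"
      "finite Y2" "Y2 \<subseteq> pverts X" "h2 \<in> supported X Y2" by blast
    then have "h1 \<in> supported X (Y1 \<union> Y2)" "h2 \<in> supported X (Y1 \<union> Y2)"
      using supported_mono[OF X, of _ "Y1 \<union> Y2"] by blast+
    with * show ?case
      using subgroup.m_closed[OF supported_subgroup[OF X, of "Y1 \<union> Y2"]]
      by (intro exI[of _ "Y1 \<union> Y2"]) simp
  qed
  then show thesis using that by blast
qed

lemma finite_set_support:
  assumes X: "pair_bidirected_digraph X" and "finite E" "E \<subseteq> carrier (L X)"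
  obtains Y where "finite Y" "Y \<subseteq> pverts X" "E \<subseteq> supported X Y"
proof -
  have "\<forall>u\<in>E. \<exists>Y. finite Y \<and> Y \<subseteq> pverts X \<and> u \<in> supported X Y"
    using assms by (meson finite_support subsetD)
  then obtain Y where Y: "\<And>u. u \<in> E \<Longrightarrow> finite (Y u) \<and> Y u \<subseteq> pverts X \<and> u \<in> supported X (Y u)"
    by metis
  have "E \<subseteq> supported X (\<Union>u\<in>E. Y u)"
  proof
    fix u assume "u \<in> E"
    then show "u \<in> supported X (\<Union>u\<in>E. Y u)"
      using Y supported_mono[OF X, of "Y u" "\<Union>u\<in>E. Y u"] by blast
  qed
  then show thesis using Y assms(2) by (intro that[of "\<Union>u\<in>E. Y u"]) auto
qed

text \<open>Both sides come from one morphism, \<open>f\<close> on \<open>D\<close> with values in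
  Y. It factors through the inclusion of D into X and also through the inclusion of W into
  Y.\<close>

lemma Lmap_incl:
  assumes X: "pair_bidirected_digraph X" and Y: "pair_bidirected_digraph Y"
    and f: "f \<in> graph_inclusions X Y" and D: "D \<subseteq> pverts X" and W: "f ` D \<subseteq> W" "W \<subseteq> pverts Y"
    and w: "w \<in> carrier (L (induced_on X D))"
  shows "Lmap X Y f (incl X D w) =
    incl Y W (Lmap (induced_on X D) (induced_on Y W) (restrict f D) w)"
proof -
  note bid = bidirected_induced_on[OF X, of D] bidirected_induced_on[OF Y, of W]
  have "Lmap X Y f (incl X D w) =
      Lmap (induced_on X D) Y (compose D f (\<lambda>y\<in>D. y)) w"
    unfolding incl_def
    using map_comp[OF bid(1) X Y inclusion_graph_inclusions[OF D] f w] by simp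
  also have "compose D f (\<lambda>y\<in>D. y) = compose D (\<lambda>y\<in>W. y) (restrict f D)"
    using W by (auto simp: compose_def fun_eq_iff)
  also have "Lmap (induced_on X D) Y \<dots> w =
      incl Y W (Lmap (induced_on X D) (induced_on Y W) (restrict f D) w)"
    unfolding incl_def
    using map_comp[OF bid Y restrict_graph_inclusions[OF f D W(1)]
        inclusion_graph_inclusions[OF W(2)] w] by simp
  finally show ?thesis .
qed

section \<open>Transport of supported elements along graph inclusions\<close>

lemma incl_inv_into:
  assumes "pair_bidirected_digraph X" "Y \<subseteq> pverts X" "u \<in> carrier (L (induced_on X Y))"
  shows "inv_into (carrier (L (induced_on X Y))) (incl X Y) (incl X Y u) = u"
  using incl_mon[OF assms(1,2)] assms(3) by (simp add: mon_def)

text \<open>The map \<open>L(\<rho>)\<close>, for \<open>\<rho>\<close> defined on \<open>Y\<close>, viewed as a map on the subgroup \<open>L(Y)\<close> of \<open>L(X)\<close>.\<close>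

definition transport ::
    "'a pair_pre_digraph \<Rightarrow> 'a set \<Rightarrow> 'a pair_pre_digraph \<Rightarrow> ('a \<Rightarrow> 'a) \<Rightarrow> 'g \<Rightarrow> 'g" where
  "transport X Y B \<rho> u =
     Lmap (induced_on X Y) B \<rho> (inv_into (carrier (L (induced_on X Y))) (incl X Y) u)"

text \<open>Later computations with \<open>transport\<close> use this form: an element is written as
  an image under the injective \<open>incl X Y\<close>, and the choice in \<open>inv_into\<close>
  disappears.\<close>

lemma transport_incl:
  assumes "pair_bidirected_digraph X" "Y \<subseteq> pverts X" "u \<in> carrier (L (induced_on X Y))"
  shows "transport X Y B \<rho> (incl X Y u) = Lmap (induced_on X Y) B \<rho> u"
  using assms by (simp add: transport_def incl_inv_into)

text \<open>On \<open>supported X Y\<close> the map is the inverse of the isomorphism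
  \<open>incl X Y\<close> onto its image, followed by the monomorphism induced by
  \<open>\<rho>\<close>. It is thus multiplicative and injective there, and so on E.\<close>

lemma transport_partial_hom:
  assumes X: "pair_bidirected_digraph X" and B: "pair_bidirected_digraph B"
    and Y: "Y \<subseteq> pverts X" and \<rho>: "\<rho> \<in> graph_inclusions (induced_on X Y) B"
    and E: "E \<subseteq> supported X Y"
  shows "transport X Y B \<rho> \<in> partial_hom (L X) E (L B)" "inj_on (transport X Y B \<rho>) E"
proof -
  note bid = bidirected_induced_on[OF X, of Y]
  have mon: "Lmap (induced_on X Y) B \<rho> \<in> mon (L (induced_on X Y)) (L B)"
    by (rule map_mon[OF bid B \<rho>])
  note incl = incl_mon[OF X Y]
  have rep: "\<exists>u\<in>carrier (L (induced_on X Y)). h = incl X Y u" if "h \<in> E" for h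
    using E that by (auto simp: supported_def)
  interpret G: group "L (induced_on X Y)" by (rule group_L[OF bid])
  show "inj_on (transport X Y B \<rho>) E"
  proof (rule inj_onI)
    fix h k assume "h \<in> E" "k \<in> E" and eq: "transport X Y B \<rho> h = transport X Y B \<rho> k"
    then obtain u v where uv: "u \<in> carrier (L (induced_on X Y))" "h = incl X Y u"
      "v \<in> carrier (L (induced_on X Y))" "k = incl X Y v" using rep by metis
    then have "u = v" using eq mon by (simp add: transport_incl[OF X Y] mon_def inj_on_def)
    then show "h = k" using uv by simp
  qed
  have "transport X Y B \<rho> (h \<otimes>\<^bsub>L X\<^esub> k) = transport X Y B \<rho> h \<otimes>\<^bsub>L B\<^esub> transport X Y B \<rho> k"
    if hk: "h \<in> E" "k \<in> E" for h k
  proof -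
    obtain u v where uv: "u \<in> carrier (L (induced_on X Y))" "h = incl X Y u"
      "v \<in> carrier (L (induced_on X Y))" "k = incl X Y v" using rep hk by metis
    then have "h \<otimes>\<^bsub>L X\<^esub> k = incl X Y (u \<otimes>\<^bsub>L (induced_on X Y)\<^esub> v)"
      using incl by (simp add: mon_def hom_def)
    then show ?thesis
      using uv mon by (simp add: transport_incl[OF X Y] mon_def hom_def)
  qed
  moreover have "transport X Y B \<rho> h \<in> carrier (L B)" if "h \<in> E" for h
    using rep[OF that] Lmap_closed[OF bid B \<rho>] by (auto simp: transport_incl[OF X Y])
  ultimately show "transport X Y B \<rho> \<in> partial_hom (L X) E (L B)"
    by (auto simp: partial_hom_def)
qed

text \<open>In the application \<open>a\<close> is the action of g, \<open>b\<close> that of its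
  inverse, and \<open>\<rho>\<close>, \<open>\<sigma>\<close> are the approximating inclusions at s
  and at \<phi>(g)s. Assumption \<open>eq\<close> compares them only at points of Y that
  \<open>b\<close> keeps in Y, so \<open>h\<close> has to be represented over the set of these
  points.\<close>

lemma transport_equivariant:
  assumes X: "pair_bidirected_digraph X" and B: "pair_bidirected_digraph B"
    and Y: "Y \<subseteq> pverts X"
    and \<rho>: "\<rho> \<in> graph_inclusions (induced_on X Y) B"
    and \<sigma>: "\<sigma> \<in> graph_inclusions (induced_on X Y) B"
    and a: "a \<in> graph_inclusions X X" and b: "b \<in> graph_inclusions X X"
    and ab: "\<And>x. x \<in> pverts X \<Longrightarrow> a (b x) = x" and ba: "\<And>x. x \<in> pverts X \<Longrightarrow> b (a x) = x"
    and eq: "\<And>x. \<lbrakk>x \<in> Y; b x \<in> Y\<rbrakk> \<Longrightarrow> \<sigma> x = \<rho> (b x)"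
    and h: "h \<in> supported X Y" "Lmap X X b h \<in> supported X Y"
  shows "transport X Y B \<sigma> h = transport X Y B \<rho> (Lmap X X b h)"
proof -
  note bid = bidirected_induced_on[OF X]
  \<comment> \<open>These are exactly the points of Y that \<open>b\<close> maps into Y, written as
    an intersection to suit \<open>supported_Int\<close>.\<close>
  define D where "D = Y \<inter> a ` Y"
  have aX: "a ` Y \<subseteq> pverts X"
    using a Y by (auto simp: graph_inclusions_def set_inclusions_def PiE_iff)
  have DX: "D \<subseteq> pverts X" and DY: "D \<subseteq> Y" using Y by (auto simp: D_def)
  have bD: "b ` D \<subseteq> Y" using ba Y by (auto simp: D_def)
  have hX: "h \<in> carrier (L X)"
    using h(1) subgroup.subset[OF supported_subgroup[OF X Y]] by blast
  have "compose (pverts X) a b = (\<lambda>x\<in>pverts X. x)"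
    using ab by (auto simp: compose_def fun_eq_iff)
  then have "Lmap X X a (Lmap X X b h) = h"
    using map_comp[OF X X X b a hX] map_id[OF X hX] by simp
  moreover obtain v where v: "v \<in> carrier (L (induced_on X Y))" "Lmap X X b h = incl X Y v"
    using h(2) by (auto simp: supported_def)
  ultimately have "h = incl X (a ` Y)
      (Lmap (induced_on X Y) (induced_on X (a ` Y)) (restrict a Y) v)"
    using Lmap_incl[OF X X a Y order_refl aX v(1)] by simp
  then have "h \<in> supported X (a ` Y)"
    unfolding supported_def
    using Lmap_closed[OF bid bid restrict_graph_inclusions[OF a Y order_refl] v(1)] by blast
  then have "h \<in> supported X D"
    using h(1) supported_Int[OF X Y aX] by (simp add: D_def)
  then obtain w where w: "w \<in> carrier (L (induced_on X D))" and hw: "h = incl X D w"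
    by (auto simp: supported_def)
  let ?j = "\<lambda>x\<in>D. x"
  have j: "?j \<in> graph_inclusions (induced_on X D) (induced_on X Y)"
    using DY by (auto simp: graph_inclusions_def set_inclusions_def inj_on_def)
  have rb: "restrict b D \<in> graph_inclusions (induced_on X D) (induced_on X Y)"
    by (rule restrict_graph_inclusions[OF b DX bD])
  \<comment> \<open>With the identity of X, \<open>Lmap_incl\<close> turns the representative
    \<open>w\<close> of \<open>h\<close> over D into one over Y, the form that
    \<open>transport_incl\<close> accepts.\<close>
  have "restrict (\<lambda>x\<in>pverts X. x) D = ?j" using DX by (auto simp: fun_eq_iff)
  then have "h = incl X Y (Lmap (induced_on X D) (induced_on X Y) ?j w)"
    using Lmap_incl[OF X X id_graph_inclusions DX _ Y w] DX DY map_id[OF X hX] hw by auto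
  then have "transport X Y B \<sigma> h =
      Lmap (induced_on X Y) B \<sigma> (Lmap (induced_on X D) (induced_on X Y) ?j w)"
    using transport_incl[OF X Y Lmap_closed[OF bid bid j w]] by simp
  also have "\<dots> = Lmap (induced_on X D) B (compose D \<sigma> ?j) w"
    using map_comp[OF bid bid B j \<sigma> w] by simp
  \<comment> \<open>The two morphisms from D to B coincide by \<open>eq\<close>; functoriality does
    the rest.\<close>
  also have "compose D \<sigma> ?j = compose D \<rho> (restrict b D)"
    using eq DY bD by (auto simp: compose_def fun_eq_iff)
  also have "Lmap (induced_on X D) B \<dots> w =
      Lmap (induced_on X Y) B \<rho> (Lmap (induced_on X D) (induced_on X Y) (restrict b D) w)"
    using map_comp[OF bid bid B rb \<rho> w] by simp
  also have "\<dots> = transport X Y B \<rho> (Lmap X X b h)"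
    using transport_incl[OF X Y Lmap_closed[OF bid bid rb w]]
      Lmap_incl[OF X X b DX bD Y w] hw by simp
  finally show ?thesis .
qed

section \<open>The induced action on L(X) and its sofic approximations\<close>

lemma graph_action_inclusion:
  assumes "graph_action \<Gamma> X \<alpha>" "g \<in> carrier \<Gamma>"
  shows "\<alpha> g \<in> graph_inclusions X X"
proof -
  interpret group_action \<Gamma> "pverts X" \<alpha> using assms(1) by (simp add: graph_action_def)
  show ?thesis
    using assms bij_prop0[of g] Bij_imp_funcset[of "\<alpha> g"]
    by (auto simp: graph_action_def graph_inclusions_def set_inclusions_def Bij_def bij_betw_def
        PiE_iff extensional_def)
qed

lemma induced_action_hom:
  assumes act: "graph_action \<Gamma> X \<alpha>"
  shows "group \<Gamma>" "induced_action (L X) (Lmap X X) \<alpha> \<in> hom \<Gamma> (AutoGroup (L X))"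
proof -
  interpret A: group_action \<Gamma> "pverts X" \<alpha> using act by (simp add: graph_action_def)
  show "group \<Gamma>" using A.group_hom by (simp add: group_hom_def)
  then interpret group \<Gamma> .
  have X: "pair_bidirected_digraph X" using act by (simp add: graph_action_def)
  note incl = graph_action_inclusion[OF act]
  let ?h = "\<lambda>g. Lmap X X (\<alpha> g)"
  have mult: "?h (g \<otimes>\<^bsub>\<Gamma>\<^esub> k) u = ?h g (?h k u)"
    if "g \<in> carrier \<Gamma>" "k \<in> carrier \<Gamma>" "u \<in> carrier (L X)" for g k u
  proof -
    have "\<alpha> (g \<otimes>\<^bsub>\<Gamma>\<^esub> k) = compose (pverts X) (\<alpha> g) (\<alpha> k)"
      using that A.bij_prop0 group_hom.hom_mult[OF A.group_hom, of g k]
      by (simp add: BijGroup_def)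
    then show ?thesis using map_comp[OF X X X incl incl] that by simp
  qed
  have one: "?h \<one>\<^bsub>\<Gamma>\<^esub> u = u" if "u \<in> carrier (L X)" for u
    using map_id[OF X that] by (simp add: A.id_eq_one)
  have closed: "?h g u \<in> carrier (L X)" if "g \<in> carrier \<Gamma>" "u \<in> carrier (L X)" for g u
    using Lmap_closed[OF X X incl] that by blast
  \<comment> \<open>A monomorphism is only known to be injective. Surjectivity comes from the
    inverse of g, whose induced map is a two-sided inverse by \<open>mult\<close> and
    \<open>one\<close>.\<close>
  have "bij_betw (?h g) (carrier (L X)) (carrier (L X))" if g: "g \<in> carrier \<Gamma>" for g
  proof (rule bij_betw_byWitness[where f' = "?h (inv\<^bsub>\<Gamma>\<^esub> g)"])
    show "\<forall>u\<in>carrier (L X). ?h (inv\<^bsub>\<Gamma>\<^esub> g) (?h g u) = u"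
      using g mult[of "inv\<^bsub>\<Gamma>\<^esub> g" g] one by simp
    show "\<forall>u\<in>carrier (L X). ?h g (?h (inv\<^bsub>\<Gamma>\<^esub> g) u) = u"
      using g mult[of g "inv\<^bsub>\<Gamma>\<^esub> g"] one by simp
  qed (use g closed in auto)
  then have Bij: "restrict (?h g) (carrier (L X)) \<in> Bij (carrier (L X))" if "g \<in> carrier \<Gamma>" for g
    using that by (simp add: Bij_def cong: bij_betw_cong)
  interpret LX: group "L X" by (rule group_L[OF X])
  have hom: "restrict (?h g) (carrier (L X)) \<in> hom (L X) (L X)" if "g \<in> carrier \<Gamma>" for g
    using map_mon[OF X X incl[OF that]] by (auto simp: mon_def hom_def)
  show "induced_action (L X) (Lmap X X) \<alpha> \<in> hom \<Gamma> (AutoGroup (L X))"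
  proof (rule homI)
    fix g assume "g \<in> carrier \<Gamma>"
    then show "induced_action (L X) (Lmap X X) \<alpha> g \<in> carrier (AutoGroup (L X))"
      using Bij hom by (simp add: induced_action_def AutoGroup_def auto_def)
  next
    fix g k assume "g \<in> carrier \<Gamma>" "k \<in> carrier \<Gamma>"
    then show "induced_action (L X) (Lmap X X) \<alpha> (g \<otimes>\<^bsub>\<Gamma>\<^esub> k) =
        induced_action (L X) (Lmap X X) \<alpha> g \<otimes>\<^bsub>AutoGroup (L X)\<^esub> induced_action (L X) (Lmap X X) \<alpha> k"
      using Bij mult closed
      by (auto simp: induced_action_def AutoGroup_def BijGroup_def compose_def fun_eq_iff)
  qed
qed

text \<open>Homomorphisms preserve inverses. This replaces the inverse in \<open>AutoGroup\<close>,
  which occurs in the definition of an automorphic approximation, by a value of the functor.\<close>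

lemma inv_induced_action:
  assumes act: "graph_action \<Gamma> X \<alpha>" and g: "g \<in> carrier \<Gamma>" and h: "h \<in> carrier (L X)"
  shows "(inv\<^bsub>AutoGroup (L X)\<^esub> (induced_action (L X) (Lmap X X) \<alpha> g)) h = Lmap X X (\<alpha> (inv\<^bsub>\<Gamma>\<^esub> g)) h"
proof -
  have "group (L X)" using act by (simp add: graph_action_def group_L)
  then interpret group_hom \<Gamma> "AutoGroup (L X)" "induced_action (L X) (Lmap X X) \<alpha>"
    using induced_action_hom[OF act]
    by (simp add: group_hom_def group_hom_axioms_def group.AutoGroup)
  show ?thesis
    unfolding hom_inv[OF g, symmetric] using h by (simp add: induced_action_def del: hom_inv)
qed

text \<open>The same \<open>A\<close>, \<open>\<phi>\<close> and \<open>S\<close> serve for the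
  induced action, so unitality and multiplicativity carry over unchanged. Only the maps
  \<open>\<pi> s\<close> are replaced, by their transports.\<close>

lemma sofic_induced_action:
  assumes universe: "infinite (UNIV :: 'a set)"
    and \<C>: "\<And>X. \<lbrakk>pair_bidirected_digraph X; finite (pverts X)\<rbrakk> \<Longrightarrow> L X \<in> \<C>"
    and sofic: "sofic_graph_action \<Gamma> X \<alpha>"
  shows "sofic_class_action \<C> \<Gamma> (L X) (induced_action (L X) (Lmap X X) \<alpha>)"
  unfolding sofic_class_action_def
proof (intro conjI allI impI; (elim conjE)?)
  have act: "graph_action \<Gamma> X \<alpha>" using sofic by (simp add: sofic_graph_action_def)
  then have X: "pair_bidirected_digraph X" by (simp add: graph_action_def)
  show "group \<Gamma>" "group (L X)" "induced_action (L X) (Lmap X X) \<alpha> \<in> hom \<Gamma> (AutoGroup (L X))"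
    using induced_action_hom[OF act] group_L[OF X] by auto
  then interpret group \<Gamma> by simp
  interpret A: group_action \<Gamma> "pverts X" \<alpha> using act by (simp add: graph_action_def)
  fix F E and \<epsilon> :: real
  assume F: "finite F" "F \<subseteq> carrier \<Gamma>" and E: "finite E" "E \<subseteq> carrier (L X)" and \<epsilon>: "\<epsilon> > 0"
  \<comment> \<open>The support is fixed first, since it is the finite vertex set for which the
    orbit approximation is then requested.\<close>
  obtain Y where Y: "finite Y" "Y \<subseteq> pverts X" and EY: "E \<subseteq> supported X Y"
    using finite_set_support[OF X E] by blast
  obtain A :: "nat set" and \<phi> where A: "finite A" "unital \<Gamma> A \<phi>" "multiplicative \<Gamma> F \<epsilon> A \<phi>"
    and orbit: "graph_orbit_approximation \<Gamma> X \<alpha> F Y \<epsilon> A \<phi>"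
    using sofic F Y \<epsilon> unfolding sofic_graph_action_def by blast
  obtain B :: "nat pair_pre_digraph" and S \<pi> where \<phi>: "\<phi> \<in> carrier \<Gamma> \<rightarrow> carrier (BijGroup A)"
    and B: "pair_bidirected_digraph B" "finite (pverts B)"
    and S: "S \<subseteq> A" "real (card S) > (1 - \<epsilon>) * real (card A)"
    and \<pi>: "\<forall>s \<in> S. \<pi> s \<in> graph_inclusions (induced_on X Y) B"
    and eq: "\<forall>g \<in> F. \<forall>x \<in> Y. \<forall>s \<in> S. \<phi> g s \<in> S \<and> (inv\<^bsub>BijGroup (pverts X)\<^esub> (\<alpha> g)) x \<in> Y \<longrightarrow>
       \<pi> (\<phi> g s) x = \<pi> s ((inv\<^bsub>BijGroup (pverts X)\<^esub> (\<alpha> g)) x)"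
    using orbit unfolding graph_orbit_approximation_def by blast
  obtain B' :: "'a pair_pre_digraph" and c where B': "pair_bidirected_digraph B'" "finite (pverts B')"
    and c: "c \<in> graph_inclusions B B'"
    using graph_inclusion_into_universe[OF universe B] by blast
  \<comment> \<open>The functor is defined on graphs over \<open>'a\<close>, so each
    \<open>\<pi> s\<close> is followed by the embedding of B into its copy B'.\<close>
  define \<rho> where "\<rho> s = compose Y c (\<pi> s)" for s
  have \<rho>: "\<rho> s \<in> graph_inclusions (induced_on X Y) B'" if "s \<in> S" for s
    using compose_graph_inclusions[OF \<pi>[rule_format, OF that] c] by (simp add: \<rho>_def)
  let ?\<beta> = "induced_action (L X) (Lmap X X) \<alpha>"
  have "transport X Y B' (\<rho> (\<phi> g s)) h = transport X Y B' (\<rho> s) ((inv\<^bsub>AutoGroup (L X)\<^esub> (?\<beta> g)) h)"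
    if g: "g \<in> F" and h: "h \<in> E" and s: "s \<in> S" and gs: "\<phi> g s \<in> S"
      and gh: "(inv\<^bsub>AutoGroup (L X)\<^esub> (?\<beta> g)) h \<in> E" for g h s
  proof -
    have g': "g \<in> carrier \<Gamma>" using g F by blast
    have inv: "(inv\<^bsub>AutoGroup (L X)\<^esub> (?\<beta> g)) h = Lmap X X (\<alpha> (inv\<^bsub>\<Gamma>\<^esub> g)) h"
      using inv_induced_action[OF act g'] h E by blast
    have "transport X Y B' (\<rho> (\<phi> g s)) h = transport X Y B' (\<rho> s) (Lmap X X (\<alpha> (inv\<^bsub>\<Gamma>\<^esub> g)) h)"
    proof (rule transport_equivariant[OF X B'(1) Y(2) \<rho>[OF s] \<rho>[OF gs],
          where a = "\<alpha> g" and b = "\<alpha> (inv\<^bsub>\<Gamma>\<^esub> g)"])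
      show "\<alpha> g \<in> graph_inclusions X X" "\<alpha> (inv\<^bsub>\<Gamma>\<^esub> g) \<in> graph_inclusions X X"
        using graph_action_inclusion[OF act] g' by simp_all
      show "\<alpha> g (\<alpha> (inv\<^bsub>\<Gamma>\<^esub> g) x) = x" "\<alpha> (inv\<^bsub>\<Gamma>\<^esub> g) (\<alpha> g x) = x" if "x \<in> pverts X" for x
        using A.composition_rule[OF that, of g "inv\<^bsub>\<Gamma>\<^esub> g"]
          A.composition_rule[OF that, of "inv\<^bsub>\<Gamma>\<^esub> g" g] that g'
        by (simp_all flip: A.id_eq_one)
      \<comment> \<open>The orbit condition is stated with the inverse permutation, which is the
        action of the inverse of g.\<close>
      have "inv\<^bsub>BijGroup (pverts X)\<^esub> (\<alpha> g) = \<alpha> (inv\<^bsub>\<Gamma>\<^esub> g)"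
        using group_hom.hom_inv[OF A.group_hom g'] by simp
      then show "\<rho> (\<phi> g s) x = \<rho> s (\<alpha> (inv\<^bsub>\<Gamma>\<^esub> g) x)" if "x \<in> Y" "\<alpha> (inv\<^bsub>\<Gamma>\<^esub> g) x \<in> Y" for x
        using eq[rule_format, of g x s] g s gs that by (simp add: \<rho>_def compose_def)
      show "h \<in> supported X Y" "Lmap X X (\<alpha> (inv\<^bsub>\<Gamma>\<^esub> g)) h \<in> supported X Y"
        using h gh EY inv by auto
    qed
    then show ?thesis using inv by simp
  qed
  then have "automorphic_approximation \<Gamma> (L X) ?\<beta> F E \<epsilon> (L B') A \<phi>"
    unfolding automorphic_approximation_def
    using \<phi> S transport_partial_hom[OF X B'(1) Y(2) \<rho> EY]
    by (intro conjI exI[of _ S] exI[of _ "\<lambda>s. transport X Y B' (\<rho> s)"] ballI impI; (elim conjE)?) blast+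
  then show "\<exists>\<Lambda>\<in>\<C>. \<exists>(A :: nat set) \<phi>. finite A \<and> unital \<Gamma> A \<phi> \<and> multiplicative \<Gamma> F \<epsilon> A \<phi> \<and>
      automorphic_approximation \<Gamma> (L X) ?\<beta> F E \<epsilon> \<Lambda> A \<phi>"
    using \<C>[OF B'] A by blast
qed

end

section \<open>Sets as edgeless graphs\<close>

lemma graph_theoretic_halo_of_set_theoretic_halo:
  assumes "set_theoretic_halo L Lmap"
  shows "graph_theoretic_halo (\<lambda>X. L (pverts X)) (\<lambda>X Y. Lmap (pverts X) (pverts Y))"
proof -
  interpret set_theoretic_halo L Lmap by (rule assms)
  \<comment> \<open>Forgetting arcs is a functor from graphs with inclusions to sets with
    injections. Composing it with the halo makes each graph axiom a set axiom at the vertex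
    sets.\<close>
  have set: "f \<in> set_inclusions (pverts X) (pverts Y)" if "f \<in> graph_inclusions X Y" for f X Y
    using that by (simp add: graph_inclusions_def)
  show ?thesis
  proof (rule graph_theoretic_halo.intro, goal_cases)
    case 1 show ?case by (rule group_L)
  next
    case 2 then show ?case by (intro map_mon set)
  next
    case 3 then show ?case by (intro map_id)
  next
    case 4 then show ?case by (intro map_comp set)
  next
    case (5 X) show ?case using halo[of "pverts X"] by simp
  qed
qed

lemma sofic_graph_action_edgeless:
  assumes "sofic_set_action \<Gamma> X \<alpha>"
  shows "sofic_graph_action \<Gamma> \<lparr>pverts = X, parcs = {}\<rparr> \<alpha>"
proof -
  have edgeless: "pair_bidirected_digraph \<lparr>pverts = Z, parcs = {}\<rparr>" for Z :: "'z set"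
    by (simp add: pair_bidirected_digraph_iff irrefl_def)
  have "graph_orbit_approximation \<Gamma> \<lparr>pverts = X, parcs = {}\<rparr> \<alpha> F E \<epsilon> A \<phi>"
    if "set_orbit_approximation \<Gamma> X \<alpha> F E \<epsilon> A \<phi>" for F E \<epsilon> and A :: "nat set" and \<phi>
  proof -
    from that obtain B :: "nat set" and S \<pi> where *: "\<phi> \<in> carrier \<Gamma> \<rightarrow> carrier (BijGroup A)"
      "finite B" "S \<subseteq> A" "real (card S) > (1 - \<epsilon>) * real (card A)"
      "\<forall>s \<in> S. \<pi> s \<in> set_inclusions E B"
      "\<forall>g \<in> F. \<forall>x \<in> E. \<forall>s \<in> S. \<phi> g s \<in> S \<and> (inv\<^bsub>BijGroup X\<^esub> (\<alpha> g)) x \<in> E \<longrightarrow>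
         \<pi> (\<phi> g s) x = \<pi> s ((inv\<^bsub>BijGroup X\<^esub> (\<alpha> g)) x)"
      unfolding set_orbit_approximation_def by blast
    then show ?thesis
      unfolding graph_orbit_approximation_def
      \<comment> \<open>The target is made edgeless too: between edgeless graphs every injection of
        vertices is an inclusion of induced subgraphs.\<close>
      by (intro conjI exI[of _ "\<lparr>pverts = B, parcs = {}\<rparr>"] exI[of _ S] exI[of _ \<pi>])
        (simp_all add: edgeless graph_inclusions_def)
  qed
  moreover have "graph_action \<Gamma> \<lparr>pverts = X, parcs = {}\<rparr> \<alpha>"
    using assms by (simp add: sofic_set_action_def graph_action_def edgeless)
  moreover have "\<exists>(A :: nat set) \<phi>. finite A \<and> unital \<Gamma> A \<phi> \<and> multiplicative \<Gamma> F \<epsilon> A \<phi> \<and>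
      set_orbit_approximation \<Gamma> X \<alpha> F E \<epsilon> A \<phi>"
    if "finite F \<and> F \<subseteq> carrier \<Gamma> \<and> finite E \<and> E \<subseteq> X \<and> \<epsilon> > 0" for F E \<epsilon>
    using assms that by (simp add: sofic_set_action_def)
  ultimately show ?thesis
    unfolding sofic_graph_action_def pair_pre_digraph.simps by fast
qed

theorem proposition1p2:
  fixes \<C> :: "'g monoid set"
    and L :: "'a set \<Rightarrow> 'g monoid"
    and Lmap :: "'a set \<Rightarrow> 'a set \<Rightarrow> ('a \<Rightarrow> 'a) \<Rightarrow> 'g \<Rightarrow> 'g"
    and M :: "'a pair_pre_digraph \<Rightarrow> 'g monoid"
    and Mmap :: "'a pair_pre_digraph \<Rightarrow> 'a pair_pre_digraph \<Rightarrow> ('a \<Rightarrow> 'a) \<Rightarrow> 'g \<Rightarrow> 'g"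
  assumes universe: "infinite (UNIV :: 'a set)"
    and class_of_groups: "\<And>\<Lambda>. \<Lambda> \<in> \<C> \<Longrightarrow> group \<Lambda>"
  shows "(set_theoretic_halo L Lmap \<and> (\<forall>X. finite X \<longrightarrow> L X \<in> \<C>) \<longrightarrow>
            (\<forall>X (\<Gamma> :: 'c monoid) \<alpha>. sofic_set_action \<Gamma> X \<alpha> \<longrightarrow>
               sofic_class_action \<C> \<Gamma> (L X) (induced_action (L X) (Lmap X X) \<alpha>)))
       \<and> (graph_theoretic_halo M Mmap \<and>
            (\<forall>X. pair_bidirected_digraph X \<and> finite (pverts X) \<longrightarrow> M X \<in> \<C>) \<longrightarrow>
            (\<forall>X (\<Gamma> :: 'c monoid) \<alpha>. sofic_graph_action \<Gamma> X \<alpha> \<longrightarrow>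
               sofic_class_action \<C> \<Gamma> (M X) (induced_action (M X) (Mmap X X) \<alpha>)))"
proof (intro conjI impI allI; elim conjE)
  fix X :: "'a set" and \<Gamma> :: "'c monoid" and \<alpha>
  assume halo: "set_theoretic_halo L Lmap" and \<C>: "\<forall>X. finite X \<longrightarrow> L X \<in> \<C>"
    and sofic: "sofic_set_action \<Gamma> X \<alpha>"
  interpret graph_theoretic_halo "\<lambda>X. L (pverts X)" "\<lambda>X Y. Lmap (pverts X) (pverts Y)"
    by (rule graph_theoretic_halo_of_set_theoretic_halo[OF halo])
  show "sofic_class_action \<C> \<Gamma> (L X) (induced_action (L X) (Lmap X X) \<alpha>)"
    \<comment> \<open>At the edgeless graph on X the pulled-back halo takes the value
      \<open>L X\<close>, and at any finite graph a value in \<open>\<C>\<close>.\<close>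
    using sofic_induced_action[OF universe _ sofic_graph_action_edgeless[OF sofic]] \<C> by simp
next
  fix X :: "'a pair_pre_digraph" and \<Gamma> :: "'c monoid" and \<alpha>
  assume halo: "graph_theoretic_halo M Mmap"
    and \<C>: "\<forall>X. pair_bidirected_digraph X \<and> finite (pverts X) \<longrightarrow> M X \<in> \<C>"
    and sofic: "sofic_graph_action \<Gamma> X \<alpha>"
  show "sofic_class_action \<C> \<Gamma> (M X) (induced_action (M X) (Mmap X X) \<alpha>)"
    using graph_theoretic_halo.sofic_induced_action[OF halo universe _ sofic] \<C> by blast
qed

end
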